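(* Let $F\colon\mathbf{Set}\to\mathbf{Set}$ be a functor preserving weak pullbacks that has a separating set of monotone predicate liftings, and assume $F$ is separable by singletons. Let $\alpha\colon X\to FX$ be a coalgebra with $X$ finite. Then $\nu\mathcal F_\alpha=W_\alpha$, i.e. the greatest fixpoint of $\mathcal F_\alpha$ consists exactly of the pairs $(x_0,x_1)\in X\times X$ from which the duplicator has a winning strategy in the bisimulation game.
   Context: For a set $Y$ with a preorder $\le$, the lifted preorder $\le^F$ on $FY$ is: $t_0\le^F t_1$ iff there is $t\in F(\le)$ with $F\pi_i(t)=t_i$ ($i=0,1$), $\pi_i\colon{\le}\to Y$ the projections. We use $2=\{0,1\}$ with $0\le1$. An evaluation map $\lambda\colon F2\to2$ induces the predicate lifting $p\mapsto\lambda\circ Fp$; it is monotone if $\lambda$ is monotone w.r.t. $\le^F$. A set $\Lambda$ of evaluation maps is separating if for every set $X$ and $t_0\ne t_1\in FX$ there are $\lambda\in\Lambda$, $p\colon X\to2$ with $\lambda(Fp(t_0))\ne\lambda(Fp(t_1))$. $F$ is separable by singletons if for every set $X$ and all $t_0\neq t_1$ in $FX$ there is $p\colon X\to 2$ with $p(x)=1$ for exactly one $x\in X$ and $Fp(t_0)\ne Fp(t_1)$. $\chi_P$ denotes the characteristic function of $P\subseteq X$; $\mathit{Eq}(X)$ is the set of equivalence relations on $X$, and $E(R)$ the set of classes of $R$. $\mathcal F_\alpha\colon\mathit{Eq}(X)\to\mathit{Eq}(X)$, $\mathcal F_\alpha(R)=\{(x_0,x_1)\in R\mid \forall P\in E(R)\colon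 F\chi_P(\alpha(x_0))=F\chi_P(\alpha(x_1))\}$, and $\nu\mathcal F_\alpha$ is its greatest fixpoint. Bisimulation game from position $(x_0,x_1)$: Step 1: spoiler $S$ chooses $j\in\{0,1\}$ and $p_j\colon X\to2$. Step 2: duplicator $D$ must respond with $p_{1-j}\colon X\to2$ with $Fp_j(\alpha(x_j))\le^F Fp_{1-j}(\alpha(x_{1-j}))$. Step 3: $S$ chooses $\ell\in\{0,1\}$ and $x'_\ell$ with $p_\ell(x'_\ell)=1$. Step 4: $D$ must respond with $x'_{1-\ell}$ with $p_{1-\ell}(x'_{1-\ell})=1$. Play continues from $(x'_0,x'_1)$. $D$ wins if the play is infinite or $S$ has no move in Step 3; $S$ wins if $D$ has no move in Step 2 or 4. $W_\alpha$ is the set of pairs $(x_0,x_1)$ from which $D$ has a winning strategy. *)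

theory Defs
  imports Main "HOL-Library.FuncSet" "HOL-Library.Infinite_Typeclass"
begin

text \<open>
  Functors on sets are modelled with the subsets of an arbitrary infinite type \<open>'u\<close> as the sets in the
  domain and the subsets of an arbitrary type \<open>'f\<close> as the sets in the codomain. A map \<open>X \<rightarrow> Y\<close> is a
  HOL function \<open>f \<in> X \<rightarrow> Y\<close>, of which only the values on \<open>X\<close> count: maps are compared on \<open>X\<close>, and
  functors respect this (last conjunct of \<open>is_functor\<close>). Infinity of \<open>'u\<close> makes the binary
  relations on subsets of \<open>'u\<close> and the two truth values available as subsets of \<open>'u\<close>. The codes
  used for this are arbitrary; only their injectivity matters.
\<close>

definition pcode :: "'u::infinite \<times> 'u \<Rightarrow> 'u" where
  "pcode = (SOME c. inj c)"

definition bcode :: "bool \<Rightarrow> 'u::infinite" where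
  "bcode = (SOME c. inj c)"

lemma inj_pcode: "inj (pcode :: 'u::infinite \<times> 'u \<Rightarrow> 'u)"
proof -
  have "(card_of (UNIV \<times> UNIV :: ('u \<times> 'u) set), card_of (UNIV :: 'u set)) \<in> ordLeq"
    using card_of_Times_same_infinite[OF infinite_UNIV] ordIso_imp_ordLeq by blast
  then obtain c :: "'u \<times> 'u \<Rightarrow> 'u" where "inj_on c (UNIV \<times> UNIV)"
    using card_of_ordLeq[of "UNIV \<times> UNIV :: ('u \<times> 'u) set" "UNIV :: 'u set"] by auto
  then have "\<exists>c :: 'u \<times> 'u \<Rightarrow> 'u. inj c" by auto
  then show ?thesis unfolding pcode_def by (rule someI_ex)
qed

lemma inj_bcode: "inj (bcode :: bool \<Rightarrow> 'u::infinite)"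
proof -
  obtain a b :: 'u where "a \<noteq> b"
    using arb_element[of "{undefined :: 'u}"] by auto
  then have "inj (\<lambda>t. if t then a else b)" by (auto simp: inj_def)
  then have "\<exists>c :: bool \<Rightarrow> 'u. inj c" by blast
  then show ?thesis unfolding bcode_def by (rule someI_ex)
qed

definition pr1 :: "'u::infinite \<Rightarrow> 'u" where
  "pr1 z = fst (inv pcode z)"

definition pr2 :: "'u::infinite \<Rightarrow> 'u" where
  "pr2 z = snd (inv pcode z)"

lemma pr_pcode [simp]: "pr1 (pcode (x, y)) = x" "pr2 (pcode (x, y)) = y"
  by (simp_all add: pr1_def pr2_def inj_pcode)

definition two :: "'u::infinite set" where
  "two = range bcode"

definition le2 :: "('u::infinite \<times> 'u) set" where
  "le2 = {(bcode a, bcode b) | a b. a \<le> b}"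


record ('u, 'f) set_functor =
  Ob :: "'u set \<Rightarrow> 'f set"
  Mor :: "'u set \<Rightarrow> 'u set \<Rightarrow> ('u \<Rightarrow> 'u) \<Rightarrow> 'f \<Rightarrow> 'f"

definition is_functor :: "('u, 'f) set_functor \<Rightarrow> bool" where
  "is_functor F \<longleftrightarrow>
     (\<forall>X Y. \<forall>f \<in> X \<rightarrow> Y. Mor F X Y f \<in> Ob F X \<rightarrow> Ob F Y) \<and>
     (\<forall>X. \<forall>t \<in> Ob F X. Mor F X X (\<lambda>x. x) t = t) \<and>
     (\<forall>X Y Z. \<forall>f \<in> X \<rightarrow> Y. \<forall>g \<in> Y \<rightarrow> Z. \<forall>t \<in> Ob F X.
        Mor F X Z (g \<circ> f) t = Mor F Y Z g (Mor F X Y f t)) \<and>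
     (\<forall>X Y. \<forall>f \<in> X \<rightarrow> Y. \<forall>g. (\<forall>x\<in>X. f x = g x) \<longrightarrow>
        (\<forall>t \<in> Ob F X. Mor F X Y f t = Mor F X Y g t))"

text \<open>The square with \<open>p : P \<rightarrow> X\<close>, \<open>q : P \<rightarrow> Y\<close>, \<open>f : X \<rightarrow> Z\<close>, \<open>g : Y \<rightarrow> Z\<close> is a weak pullback.\<close>

definition weak_pullback ::
  "'a set \<Rightarrow> 'a set \<Rightarrow> 'a set \<Rightarrow> 'a set \<Rightarrow>
   ('a \<Rightarrow> 'a) \<Rightarrow> ('a \<Rightarrow> 'a) \<Rightarrow> ('a \<Rightarrow> 'a) \<Rightarrow> ('a \<Rightarrow> 'a) \<Rightarrow> bool" where
  "weak_pullback P X Y Z p q f g \<longleftrightarrow>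
     p \<in> P \<rightarrow> X \<and> q \<in> P \<rightarrow> Y \<and> f \<in> X \<rightarrow> Z \<and> g \<in> Y \<rightarrow> Z \<and>
     (\<forall>w\<in>P. f (p w) = g (q w)) \<and>
     (\<forall>Q :: 'a set. \<forall>h \<in> Q \<rightarrow> X. \<forall>k \<in> Q \<rightarrow> Y. (\<forall>w\<in>Q. f (h w) = g (k w)) \<longrightarrow>
        (\<exists>m \<in> Q \<rightarrow> P. \<forall>w\<in>Q. p (m w) = h w \<and> q (m w) = k w))"

definition preserves_weak_pullbacks :: "('u, 'f) set_functor \<Rightarrow> bool" where
  "preserves_weak_pullbacks F \<longleftrightarrow>
     (\<forall>P X Y Z p q f g. weak_pullback P X Y Z p q f g \<longrightarrow>
        weak_pullback (Ob F P) (Ob F X) (Ob F Y) (Ob F Z)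
          (Mor F P X p) (Mor F P Y q) (Mor F X Z f) (Mor F Y Z g))"

text \<open>\<open>Ob F (pcode ` r)\<close> is \<open>F\<close> applied to the preorder \<open>r \<subseteq> Y \<times> Y\<close>, regarded as a set.\<close>

definition lift_rel ::
  "('u::infinite, 'f) set_functor \<Rightarrow> 'u set \<Rightarrow> ('u \<times> 'u) set \<Rightarrow> 'f \<Rightarrow> 'f \<Rightarrow> bool" where
  "lift_rel F Y r t0 t1 \<longleftrightarrow>
     (\<exists>t \<in> Ob F (pcode ` r). Mor F (pcode ` r) Y pr1 t = t0 \<and> Mor F (pcode ` r) Y pr2 t = t1)"

abbreviation le2F :: "('u::infinite, 'f) set_functor \<Rightarrow> 'f \<Rightarrow> 'f \<Rightarrow> bool" where
  "le2F F \<equiv> lift_rel F two le2"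

text \<open>A map \<open>X \<rightarrow> 2\<close> is given by a predicate \<open>p\<close> on \<open>'u\<close>; \<open>Mor2 F X p : F X \<rightarrow> F 2\<close> is its image
  under \<open>F\<close>. An evaluation map \<open>F 2 \<rightarrow> 2\<close> is likewise a predicate on \<open>'f\<close>.\<close>

definition Mor2 :: "('u::infinite, 'f) set_functor \<Rightarrow> 'u set \<Rightarrow> ('u \<Rightarrow> bool) \<Rightarrow> 'f \<Rightarrow> 'f" where
  "Mor2 F X p = Mor F X two (bcode \<circ> p)"

definition pred_lifting ::
  "('u::infinite, 'f) set_functor \<Rightarrow> ('f \<Rightarrow> bool) \<Rightarrow> 'u set \<Rightarrow> ('u \<Rightarrow> bool) \<Rightarrow> 'f \<Rightarrow> bool" where
  "pred_lifting F ev X p = ev \<circ> Mor2 F X p"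

definition monotone_eval :: "('u::infinite, 'f) set_functor \<Rightarrow> ('f \<Rightarrow> bool) \<Rightarrow> bool" where
  "monotone_eval F ev \<longleftrightarrow> monotone_on (Ob F two) (le2F F) (\<le>) ev"

definition separating :: "('u::infinite, 'f) set_functor \<Rightarrow> ('f \<Rightarrow> bool) set \<Rightarrow> bool" where
  "separating F \<Lambda> \<longleftrightarrow>
     (\<forall>X. \<forall>t0 \<in> Ob F X. \<forall>t1 \<in> Ob F X. t0 \<noteq> t1 \<longrightarrow>
        (\<exists>ev\<in>\<Lambda>. \<exists>p. pred_lifting F ev X p t0 \<noteq> pred_lifting F ev X p t1))"

definition separable_by_singletons :: "('u::infinite, 'f) set_functor \<Rightarrow> bool" where
  "separable_by_singletons F \<longleftrightarrow>
     (\<forall>X. \<forall>t0 \<in> Ob F X. \<forall>t1 \<in> Ob F X. t0 \<noteq> t1 \<longrightarrow>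
        (\<exists>p. (\<exists>!x. x \<in> X \<and> p x) \<and> Mor2 F X p t0 \<noteq> Mor2 F X p t1))"


definition F_alpha ::
  "('u::infinite, 'f) set_functor \<Rightarrow> 'u set \<Rightarrow> ('u \<Rightarrow> 'f) \<Rightarrow> ('u \<times> 'u) set \<Rightarrow> ('u \<times> 'u) set" where
  "F_alpha F X \<alpha> R =
     {(x0, x1) \<in> R. \<forall>P \<in> X // R. Mor2 F X (\<lambda>x. x \<in> P) (\<alpha> x0) = Mor2 F X (\<lambda>x. x \<in> P) (\<alpha> x1)}"

lemma equiv_F_alpha: "equiv X R \<Longrightarrow> equiv X (F_alpha F X \<alpha> R)"
  by (rule equivI) (auto simp: F_alpha_def elim!: equivE intro: refl_onI symI transI
    dest: refl_onD symD transD)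

definition nu_F_alpha ::
  "('u::infinite, 'f) set_functor \<Rightarrow> 'u set \<Rightarrow> ('u \<Rightarrow> 'f) \<Rightarrow> ('u \<times> 'u) set" where
  "nu_F_alpha F X \<alpha> = (GREATEST R. equiv X R \<and> F_alpha F X \<alpha> R = R)"


text \<open>
  The indices 0 and 1 are rendered as \<open>False\<close> and \<open>True\<close>, so that \<open>\<not> j\<close> is \<open>1 - j\<close> and a pair
  \<open>(x\<^sub>0, x\<^sub>1)\<close> is a function on \<open>bool\<close>. \<open>Pos i\<close> is a position in which step \<open>i\<close> is to be carried out,
  together with the data that the rest of the game depends on.
\<close>

datatype 'u position =
    Pos1 "bool \<Rightarrow> 'u"
  | Pos2 "bool \<Rightarrow> 'u" bool "'u \<Rightarrow> bool"
  | Pos3 "bool \<Rightarrow> 'u \<Rightarrow> bool"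
  | Pos4 "bool \<Rightarrow> 'u \<Rightarrow> bool" bool 'u

fun duplicator_turn :: "'u position \<Rightarrow> bool" where
  "duplicator_turn (Pos1 x) = False"
| "duplicator_turn (Pos2 x j p) = True"
| "duplicator_turn (Pos3 p) = False"
| "duplicator_turn (Pos4 p l y) = True"

inductive move ::
  "('u::infinite, 'f) set_functor \<Rightarrow> 'u set \<Rightarrow> ('u \<Rightarrow> 'f) \<Rightarrow> 'u position \<Rightarrow> 'u position \<Rightarrow> bool"
  for F X \<alpha> where
  step1: "move F X \<alpha> (Pos1 x) (Pos2 x j q)"
| step2: "p j = q \<Longrightarrow>
    le2F F (Mor2 F X (p j) (\<alpha> (x j))) (Mor2 F X (p (\<not> j)) (\<alpha> (x (\<not> j)))) \<Longrightarrow>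
    move F X \<alpha> (Pos2 x j q) (Pos3 p)"
| step3: "y \<in> X \<Longrightarrow> p l y \<Longrightarrow> move F X \<alpha> (Pos3 p) (Pos4 p l y)"
| step4: "x l = y \<Longrightarrow> x (\<not> l) \<in> X \<Longrightarrow> p (\<not> l) (x (\<not> l)) \<Longrightarrow> move F X \<alpha> (Pos4 p l y) (Pos1 x)"

text \<open>
  A strategy of the duplicator maps a history (the nonempty list of all positions so far, ending in
  one where it is the duplicator's turn) to the next position. Histories following \<open>\<sigma>\<close> from \<open>v\<close>
  contain legal moves only; if \<open>\<sigma>\<close> proposes an illegal move, the play ends there, lost for
  the duplicator.
\<close>

inductive follows ::
  "('u::infinite, 'f) set_functor \<Rightarrow> 'u set \<Rightarrow> ('u \<Rightarrow> 'f) \<Rightarrow>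
   ('u position list \<Rightarrow> 'u position) \<Rightarrow> 'u position \<Rightarrow> 'u position list \<Rightarrow> bool"
  for F X \<alpha> \<sigma> v where
  start: "follows F X \<alpha> \<sigma> v [v]"
| spoiler: "follows F X \<alpha> \<sigma> v h \<Longrightarrow> \<not> duplicator_turn (last h) \<Longrightarrow> move F X \<alpha> (last h) w \<Longrightarrow>
    follows F X \<alpha> \<sigma> v (h @ [w])"
| duplicator: "follows F X \<alpha> \<sigma> v h \<Longrightarrow> duplicator_turn (last h) \<Longrightarrow> move F X \<alpha> (last h) (\<sigma> h) \<Longrightarrow>
    follows F X \<alpha> \<sigma> v (h @ [\<sigma> h])"

datatype 'u play = Finite "'u position list" | Infinite "nat \<Rightarrow> 'u position"

fun maximal_play ::
  "('u::infinite, 'f) set_functor \<Rightarrow> 'u set \<Rightarrow> ('u \<Rightarrow> 'f) \<Rightarrow>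
   ('u position list \<Rightarrow> 'u position) \<Rightarrow> 'u position \<Rightarrow> 'u play \<Rightarrow> bool" where
  "maximal_play F X \<alpha> \<sigma> v (Finite h) \<longleftrightarrow>
     follows F X \<alpha> \<sigma> v h \<and> \<not> (\<exists>w. follows F X \<alpha> \<sigma> v (h @ [w]))"
| "maximal_play F X \<alpha> \<sigma> v (Infinite s) \<longleftrightarrow> (\<forall>n. follows F X \<alpha> \<sigma> v (map s [0..<Suc n]))"

fun duplicator_wins :: "'u play \<Rightarrow> bool" where
  "duplicator_wins (Finite h) \<longleftrightarrow> \<not> duplicator_turn (last h)"
| "duplicator_wins (Infinite s) \<longleftrightarrow> True"

definition winning_strategy ::
  "('u::infinite, 'f) set_functor \<Rightarrow> 'u set \<Rightarrow> ('u \<Rightarrow> 'f) \<Rightarrow>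
   ('u position list \<Rightarrow> 'u position) \<Rightarrow> 'u position \<Rightarrow> bool" where
  "winning_strategy F X \<alpha> \<sigma> v \<longleftrightarrow> (\<forall>\<pi>. maximal_play F X \<alpha> \<sigma> v \<pi> \<longrightarrow> duplicator_wins \<pi>)"

definition W_alpha ::
  "('u::infinite, 'f) set_functor \<Rightarrow> 'u set \<Rightarrow> ('u \<Rightarrow> 'f) \<Rightarrow> ('u \<times> 'u) set" where
  "W_alpha F X \<alpha> =
     {(x0, x1) \<in> X \<times> X. \<exists>\<sigma>. winning_strategy F X \<alpha> \<sigma> (Pos1 (\<lambda>j. if j then x1 else x0))}"

end

theory Submission imports Defs begin

text \<open>
  \<open>\<F>\<^sub>\<alpha>(R)\<close> relates \<open>x\<^sub>0\<close> and \<open>x\<^sub>1\<close> iff \<open>\<alpha>(x\<^sub>0)\<close> and \<open>\<alpha>(x\<^sub>1)\<close> become equal under \<open>F\<close> applied to the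
  quotient map of \<open>R\<close>: this is where separability by singletons enters, and it makes \<open>\<F>\<^sub>\<alpha>\<close> monotone
  and lets the duplicator, inside \<open>\<nu>\<F>\<^sub>\<alpha>\<close>, answer a predicate by its saturation. Conversely, a
  separating set of monotone evaluation maps yields, for any two distinct elements of \<open>F 2\<close>, a single
  monotone evaluation map distinguishing them (a negation on \<open>2\<close> reverses the lifted order and is
  compensated by negating the evaluation map). Hence, if a class \<open>P\<close> of the \<open>i\<close>-th iterate of
  \<open>\<F>\<^sub>\<alpha>\<close> separates \<open>x\<^sub>0\<close> from \<open>x\<^sub>1\<close>, the spoiler can play \<open>\<chi>\<^sub>P\<close> at one of them so that every answer of
  the duplicator leaves \<open>P\<close>; the next pair lies outside the \<open>i\<close>-th iterate, and the spoiler wins by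
  induction on \<open>i\<close>.
\<close>

section \<open>The action of \<open>F\<close> on maps and predicates\<close>

lemma Mor_in_Ob:
  "is_functor F \<Longrightarrow> f \<in> X \<rightarrow> Y \<Longrightarrow> t \<in> Ob F X \<Longrightarrow> Mor F X Y f t \<in> Ob F Y"
  unfolding is_functor_def by (elim conjE) (rule funcset_mem, simp_all)

lemma Mor_comp:
  "is_functor F \<Longrightarrow> f \<in> X \<rightarrow> Y \<Longrightarrow> g \<in> Y \<rightarrow> Z \<Longrightarrow> t \<in> Ob F X \<Longrightarrow>
    Mor F Y Z g (Mor F X Y f t) = Mor F X Z (g \<circ> f) t"
  unfolding is_functor_def by simp

lemma Mor_cong:
  "is_functor F \<Longrightarrow> f \<in> X \<rightarrow> Y \<Longrightarrow> (\<And>x. x \<in> X \<Longrightarrow> f x = g x) \<Longrightarrow> t \<in> Ob F X \<Longrightarrow>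
    Mor F X Y f t = Mor F X Y g t"
  unfolding is_functor_def by (elim conjE) simp

lemma bcode_in_two: "bcode \<circ> p \<in> X \<rightarrow> two"
  by (auto simp: two_def)

lemma Mor2_in_Ob: "is_functor F \<Longrightarrow> t \<in> Ob F X \<Longrightarrow> Mor2 F X p t \<in> Ob F two"
  unfolding Mor2_def by (rule Mor_in_Ob[OF _ bcode_in_two])

lemma Mor2_cong:
  "is_functor F \<Longrightarrow> (\<And>x. x \<in> X \<Longrightarrow> p x = q x) \<Longrightarrow> t \<in> Ob F X \<Longrightarrow> Mor2 F X p t = Mor2 F X q t"
  unfolding Mor2_def by (rule Mor_cong[OF _ bcode_in_two]) auto

lemma Mor2_Mor:
  "is_functor F \<Longrightarrow> f \<in> X \<rightarrow> Y \<Longrightarrow> t \<in> Ob F X \<Longrightarrow> Mor2 F Y p (Mor F X Y f t) = Mor2 F X (p \<circ> f) t"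
  unfolding Mor2_def by (simp add: Mor_comp bcode_in_two comp_assoc)

section \<open>The lifted order on \<open>F 2\<close> and monotone evaluation maps\<close>

text \<open>The pairing of \<open>p\<close> and \<open>q\<close> maps \<open>X\<close> into the
  order on 2. Its image under \<open>F\<close>, applied to \<open>t\<close>, is the witness, since
  composing with the projections recovers \<open>p\<close> and \<open>q\<close>.\<close>

lemma le2F_Mor2:
  fixes F :: "('u::infinite, 'f) set_functor"
  assumes F: "is_functor F" and t: "t \<in> Ob F X" and le: "\<And>x. x \<in> X \<Longrightarrow> p x \<le> q x"
  shows "le2F F (Mor2 F X p t) (Mor2 F X q t)"
proof -
  let ?d = "\<lambda>x. pcode (bcode (p x), bcode (q x) :: 'u)"
  have d: "?d \<in> X \<rightarrow> pcode ` le2"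
    using le by (fastforce simp: le2_def)
  have pr: "pr1 \<in> pcode ` (le2 :: ('u \<times> 'u) set) \<rightarrow> two" "pr2 \<in> pcode ` (le2 :: ('u \<times> 'u) set) \<rightarrow> two"
    by (auto simp: le2_def two_def)
  have "pr1 \<circ> ?d = bcode \<circ> p" "pr2 \<circ> ?d = bcode \<circ> q" by auto
  then have "Mor F (pcode ` le2) two pr1 (Mor F X (pcode ` le2) ?d t) = Mor2 F X p t"
    "Mor F (pcode ` le2) two pr2 (Mor F X (pcode ` le2) ?d t) = Mor2 F X q t"
    by (simp_all only: Mor_comp[OF F d pr(1) t] Mor_comp[OF F d pr(2) t] Mor2_def)
  with Mor_in_Ob[OF F d t] show ?thesis unfolding lift_rel_def by blast
qed

text \<open>One witness \<open>w\<close> over the order on 2 serves for all \<open>p\<close>: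
  postcomposition with \<open>p\<close> becomes a pair of predicates on that order, to which
  \<open>le2F_Mor2\<close> applies.\<close>

lemma le2F_E:
  fixes F :: "('u::infinite, 'f) set_functor"
  assumes "is_functor F" "le2F F s t"
  obtains w where "w \<in> Ob F (pcode ` le2)"
    "\<And>p. Mor2 F two p s = Mor2 F (pcode ` le2) (p \<circ> pr1) w"
    "\<And>p. Mor2 F two p t = Mor2 F (pcode ` le2) (p \<circ> pr2) w"
proof -
  have pr: "pr1 \<in> pcode ` (le2 :: ('u \<times> 'u) set) \<rightarrow> two" "pr2 \<in> pcode ` (le2 :: ('u \<times> 'u) set) \<rightarrow> two"
    by (auto simp: le2_def two_def)
  obtain w where w: "w \<in> Ob F (pcode ` le2)"
    "Mor F (pcode ` le2) two pr1 w = s" "Mor F (pcode ` le2) two pr2 w = t"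
    using assms(2) unfolding lift_rel_def by blast
  show thesis
    by (rule that[OF w(1)])
      (rule Mor2_Mor[OF assms(1) pr(1) w(1), unfolded w] Mor2_Mor[OF assms(1) pr(2) w(1), unfolded w])+
qed

lemma le2F_Mor2_two:
  assumes F: "is_functor F" and le: "le2F F s t" and p: "p (bcode False) \<le> p (bcode True)"
  shows "le2F F (Mor2 F two p s) (Mor2 F two p t)"
proof -
  obtain w where w: "w \<in> Ob F (pcode ` le2)"
    "\<And>p. Mor2 F two p s = Mor2 F (pcode ` le2) (p \<circ> pr1) w"
    "\<And>p. Mor2 F two p t = Mor2 F (pcode ` le2) (p \<circ> pr2) w"
    by (rule le2F_E[OF F le]) blast
  have "(p \<circ> pr1) x \<le> (p \<circ> pr2) x" if "x \<in> pcode ` le2" for x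
  proof -
    from that obtain a b where "a \<le> b" "x = pcode (bcode a, bcode b)" by (auto simp: le2_def)
    then show ?thesis using p by (cases a; cases b) auto
  qed
  then show ?thesis unfolding w(2,3) by (intro le2F_Mor2[OF F w(1), where p = "p \<circ> pr1" and q = "p \<circ> pr2"])
qed

lemma le2F_Mor2_two_antimono:
  assumes F: "is_functor F" and le: "le2F F s t" and p: "p (bcode True) \<le> p (bcode False)"
  shows "le2F F (Mor2 F two p t) (Mor2 F two p s)"
proof -
  obtain w where w: "w \<in> Ob F (pcode ` le2)"
    "\<And>p. Mor2 F two p s = Mor2 F (pcode ` le2) (p \<circ> pr1) w"
    "\<And>p. Mor2 F two p t = Mor2 F (pcode ` le2) (p \<circ> pr2) w"
    by (rule le2F_E[OF F le]) blast
  have "(p \<circ> pr2) x \<le> (p \<circ> pr1) x" if "x \<in> pcode ` le2" for x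
  proof -
    from that obtain a b where "a \<le> b" "x = pcode (bcode a, bcode b)" by (auto simp: le2_def)
    then show ?thesis using p by (cases a; cases b) auto
  qed
  then show ?thesis unfolding w(2,3) by (intro le2F_Mor2[OF F w(1), where p = "p \<circ> pr2" and q = "p \<circ> pr1"])
qed

lemma monotone_eval_separates_two:
  fixes F :: "('u::infinite, 'f) set_functor"
  assumes F: "is_functor F"
    and \<Lambda>: "\<forall>ev\<in>\<Lambda>. monotone_eval F ev" "separating F \<Lambda>"
    and t: "t0 \<in> Ob F two" "t1 \<in> Ob F two" "t0 \<noteq> t1"
  obtains ev where "monotone_eval F ev" "ev t0 \<noteq> ev t1"
proof -
  obtain ev p where ev: "ev \<in> \<Lambda>" and ne: "ev (Mor2 F two p t0) \<noteq> ev (Mor2 F two p t1)"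
    using \<Lambda>(2) t unfolding separating_def pred_lifting_def comp_apply by blast
  have mono: "monotone_on (Ob F two) (le2F F) (\<le>) ev"
    using ev \<Lambda>(1) unfolding monotone_eval_def by blast
  \<comment> \<open>Since \<open>bool\<close> is linearly ordered, every map from 2 to 2 preserves
    or reverses the order. It is absorbed into \<open>ev\<close>, with a negation in the reversing
    case.\<close>
  consider "p (bcode False) \<le> p (bcode True)" | "p (bcode True) \<le> p (bcode False)"
    by (rule linear[THEN disjE])
  then show thesis
  proof cases
    case 1
    have "monotone_eval F (\<lambda>t. ev (Mor2 F two p t))"
      unfolding monotone_eval_def
      by (intro monotone_onI monotone_onD[OF mono] Mor2_in_Ob F le2F_Mor2_two[OF F _ 1])
    with ne show thesis by (rule that[rotated])
  next
    case 2
    have "monotone_eval F (\<lambda>t. \<not> ev (Mor2 F two p t))"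
      unfolding monotone_eval_def
    proof (rule monotone_onI)
      fix s t assume "s \<in> Ob F two" "t \<in> Ob F two" "le2F F s t"
      then have "ev (Mor2 F two p t) \<le> ev (Mor2 F two p s)"
        by (intro monotone_onD[OF mono] Mor2_in_Ob F le2F_Mor2_two_antimono[OF F _ 2])
      then show "(\<not> ev (Mor2 F two p s)) \<le> (\<not> ev (Mor2 F two p t))" by auto
    qed
    with ne show thesis using that by auto
  qed
qed

text \<open>The spoiler plays \<open>q\<close> on the side \<open>j\<close> whose value
  \<open>ev\<close> accepts. An answer contained in \<open>q\<close> would carry acceptance over to
  the other side, where \<open>ev\<close> rejects.\<close>

lemma spoiler_choice:
  fixes F :: "('u::infinite, 'f) set_functor" and x :: "bool \<Rightarrow> 'u"
  assumes F: "is_functor F"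
    and \<Lambda>: "\<forall>ev\<in>\<Lambda>. monotone_eval F ev" "separating F \<Lambda>"
    and t: "\<And>b. t b \<in> Ob F X"
    and ne: "Mor2 F X q (t False) \<noteq> Mor2 F X q (t True)"
  obtains j where "\<And>p. le2F F (Mor2 F X q (t j)) (Mor2 F X p (t (\<not> j))) \<Longrightarrow> \<exists>y\<in>X. p y \<and> \<not> q y"
proof -
  obtain ev where mono: "monotone_eval F ev"
    and ne: "ev (Mor2 F X q (t False)) \<noteq> ev (Mor2 F X q (t True))"
    by (rule monotone_eval_separates_two[OF F \<Lambda> Mor2_in_Ob[OF F t] Mor2_in_Ob[OF F t] ne]) blast
  obtain j where j: "ev (Mor2 F X q (t j))" "\<not> ev (Mor2 F X q (t (\<not> j)))"
    using ne by (cases "ev (Mor2 F X q (t False))") force+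
  have ev_mono: "ev v" if "le2F F u v" "ev u" "u \<in> Ob F two" "v \<in> Ob F two" for u v
    using mono that by (auto simp: monotone_eval_def monotone_on_def)
  have "\<exists>y\<in>X. p y \<and> \<not> q y" if p: "le2F F (Mor2 F X q (t j)) (Mor2 F X p (t (\<not> j)))" for p
  proof (rule ccontr)
    assume "\<not> (\<exists>y\<in>X. p y \<and> \<not> q y)"
    then have "le2F F (Mor2 F X p (t (\<not> j))) (Mor2 F X q (t (\<not> j)))"
      by (intro le2F_Mor2 F t) auto
    then show False
      using j p ev_mono Mor2_in_Ob[OF F t] by metis
  qed
  then show thesis by (rule that)
qed

section \<open>Quotients and the iteration towards the greatest fixpoint\<close>

text \<open>Every \<open>R\<close>-invariant predicate factors through the quotient map of
  \<open>R\<close>, and \<open>F\<close> of that map identifies \<open>\<alpha> x0\<close> with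
  \<open>\<alpha> x1\<close>.\<close>

lemma F_alpha_saturated:
  fixes F :: "('u::infinite, 'f) set_functor"
  assumes F: "is_functor F" and sep: "separable_by_singletons F" and \<alpha>: "\<alpha> \<in> X \<rightarrow> Ob F X"
    and R: "equiv X R" and x: "(x0, x1) \<in> F_alpha F X \<alpha> R"
    and p: "\<And>x y. (x, y) \<in> R \<Longrightarrow> p x = p y"
  shows "Mor2 F X p (\<alpha> x0) = Mor2 F X p (\<alpha> x1)"
proof -
  \<comment> \<open>Objects are subsets of \<open>'u\<close>, so the quotient is realised by chosen
    representatives. The choice depends on the class alone, which makes \<open>rep\<close> constant
    on classes.\<close>
  define rep where "rep x = (SOME y. y \<in> R `` {x})" for x
  have rep: "(x, rep x) \<in> R" if "x \<in> X" for x
  proof -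
    have "x \<in> R `` {x}" using R that by (auto simp: equiv_def refl_on_def)
    then show ?thesis unfolding rep_def by (rule someI2) simp
  qed
  have rep_eq: "rep x = rep y" if "(x, y) \<in> R" for x y
    using equiv_class_eq[OF R that] by (simp add: rep_def)
  let ?Y = "rep ` X"
  have m: "rep \<in> X \<rightarrow> ?Y" by auto
  have "(x0, x1) \<in> R" using x by (auto simp: F_alpha_def)
  then have "x0 \<in> X" "x1 \<in> X" using R by (auto simp: equiv_def refl_on_def)
  then have t: "\<alpha> x0 \<in> Ob F X" "\<alpha> x1 \<in> Ob F X" using \<alpha> by auto
  \<comment> \<open>Separability is used at the set \<open>?Y\<close> of representatives: a
    predicate true at exactly one of them pulls back along \<open>rep\<close> to a class of
    \<open>R\<close>, and on classes both sides agree.\<close>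
  have eq: "Mor F X ?Y rep (\<alpha> x0) = Mor F X ?Y rep (\<alpha> x1)"
  proof (rule ccontr)
    assume ne: "Mor F X ?Y rep (\<alpha> x0) \<noteq> Mor F X ?Y rep (\<alpha> x1)"
    obtain s where s: "\<exists>!y. y \<in> ?Y \<and> s y"
      and ne: "Mor2 F ?Y s (Mor F X ?Y rep (\<alpha> x0)) \<noteq> Mor2 F ?Y s (Mor F X ?Y rep (\<alpha> x1))"
      using sep[unfolded separable_by_singletons_def, rule_format,
        OF Mor_in_Ob[OF F m t(1)] Mor_in_Ob[OF F m t(2)] ne]
      by (elim exE conjE)
    from s obtain z where z: "z \<in> X" "s (rep z)" and uniq: "\<And>y. y \<in> X \<Longrightarrow> s (rep y) \<Longrightarrow> rep y = rep z"
      by auto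
    have cls: "(s \<circ> rep) y = (y \<in> R `` {z})" if "y \<in> X" for y
    proof
      assume "(s \<circ> rep) y"
      then have "rep y = rep z" using uniq that by simp
      then have "(z, rep y) \<in> R" "(y, rep y) \<in> R" using rep[OF z(1)] rep[OF that] by simp_all
      then show "y \<in> R `` {z}" using R unfolding equiv_def by (blast dest: symD transD)
    next
      assume "y \<in> R `` {z}"
      then show "(s \<circ> rep) y" using rep_eq[of z y] z(2) by simp
    qed
    have "R `` {z} \<in> X // R" using z(1) by (rule quotientI)
    then have "Mor2 F X (\<lambda>x. x \<in> R `` {z}) (\<alpha> x0) = Mor2 F X (\<lambda>x. x \<in> R `` {z}) (\<alpha> x1)"
      using x unfolding F_alpha_def by blast
    moreover have "Mor2 F X (s \<circ> rep) t = Mor2 F X (\<lambda>x. x \<in> R `` {z}) t" if "t \<in> Ob F X" for t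
      by (rule Mor2_cong[OF F cls that])
    ultimately have "Mor2 F X (s \<circ> rep) (\<alpha> x0) = Mor2 F X (s \<circ> rep) (\<alpha> x1)"
      using t by (simp del: comp_apply)
    then show False
      using ne unfolding Mor2_Mor[OF F m t(1)] Mor2_Mor[OF F m t(2)] by contradiction
  qed
  have "Mor2 F X p t = Mor2 F ?Y p (Mor F X ?Y rep t)" if "t \<in> Ob F X" for t
    unfolding Mor2_Mor[OF F m that] using p[OF rep] by (intro Mor2_cong[OF F _ that]) simp
  from this[OF t(1)] this[OF t(2)] show ?thesis unfolding eq by simp
qed

text \<open>Each class of the coarser \<open>S\<close> is a union of classes of \<open>R\<close>,
  hence an \<open>R\<close>-invariant predicate covered by \<open>F_alpha_saturated\<close>.\<close>

lemma F_alpha_mono: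
  assumes F: "is_functor F" and sep: "separable_by_singletons F" and \<alpha>: "\<alpha> \<in> X \<rightarrow> Ob F X"
    and R: "equiv X R" and S: "equiv X S" and le: "R \<subseteq> S"
  shows "F_alpha F X \<alpha> R \<subseteq> F_alpha F X \<alpha> S"
proof (rule subrelI)
  fix x0 x1 assume x: "(x0, x1) \<in> F_alpha F X \<alpha> R"
  have "Mor2 F X (\<lambda>x. x \<in> P) (\<alpha> x0) = Mor2 F X (\<lambda>x. x \<in> P) (\<alpha> x1)" if P: "P \<in> X // S" for P
  proof (rule F_alpha_saturated[OF F sep \<alpha> R x])
    fix x y assume "(x, y) \<in> R"
    then have "(x, y) \<in> S" "(y, x) \<in> S" using le S by (auto simp: equiv_def dest: symD)
    then show "(x \<in> P) = (y \<in> P)" using in_quotient_imp_closed[OF S P] by blast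
  qed
  moreover have "(x0, x1) \<in> S" using x le by (auto simp: F_alpha_def)
  ultimately show "(x0, x1) \<in> F_alpha F X \<alpha> S" by (auto simp: F_alpha_def)
qed

lemma equiv_F_alpha_iterate: "equiv X ((F_alpha F X \<alpha> ^^ n) (X \<times> X))"
proof (induction n)
  case 0
  show ?case by (auto simp: equiv_def refl_on_def sym_def trans_def)
qed (simp add: equiv_F_alpha)

text \<open>The iterates decrease from the full relation and stabilise because \<open>X\<close> is
  finite. The stable value is a fixpoint, and by monotonicity every fixpoint lies below all
  iterates, so \<open>GREATEST\<close> denotes an actual maximum.\<close>

lemma nu_F_alpha_iterate:
  assumes F: "is_functor F" and sep: "separable_by_singletons F" and \<alpha>: "\<alpha> \<in> X \<rightarrow> Ob F X"
    and fin: "finite X"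
  obtains n where "nu_F_alpha F X \<alpha> = (F_alpha F X \<alpha> ^^ n) (X \<times> X)"
    and "F_alpha F X \<alpha> (nu_F_alpha F X \<alpha>) = nu_F_alpha F X \<alpha>"
proof -
  let ?S = "\<lambda>n. (F_alpha F X \<alpha> ^^ n) (X \<times> X)"
  have dec: "?S (Suc n) \<subseteq> ?S n" for n by (auto simp: F_alpha_def)
  have sub: "?S n \<subseteq> X \<times> X" for n
    using equiv_F_alpha_iterate[where F = F and X = X and \<alpha> = \<alpha> and n = n] by (auto simp: equiv_def refl_on_def)
  have "\<exists>n. ?S (Suc n) = ?S n"
  proof (rule ccontr)
    assume "\<nexists>n. ?S (Suc n) = ?S n"
    then have "card (?S (Suc n)) < card (?S n)" for n
      using dec[of n] fin sub[of n] by (intro psubset_card_mono) (auto intro: finite_subset)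
    then have lt: "Suc (card (?S (Suc n))) \<le> card (?S n)" for n by (rule Suc_leI)
    have "card (?S n) + n \<le> card (?S 0)" for n
    proof (induction n)
      case (Suc n)
      with lt[of n] show ?case by linarith
    qed simp
    from this[of "Suc (card (?S 0))"] show False by simp
  qed
  then obtain n where n: "F_alpha F X \<alpha> (?S n) = ?S n" by auto
  have "R \<subseteq> ?S i" if R: "equiv X R" "F_alpha F X \<alpha> R = R" for R i
  proof (induction i)
    case 0
    show ?case using R by (auto simp: equiv_def refl_on_def)
  next
    case (Suc i)
    from F_alpha_mono[OF F sep \<alpha> R(1) equiv_F_alpha_iterate Suc.IH] show ?case by (simp add: R(2))
  qed
  then have "nu_F_alpha F X \<alpha> = ?S n"
    unfolding nu_F_alpha_def using n by (intro Greatest_equality) (auto intro: equiv_F_alpha_iterate)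
  with n show thesis by (intro that) auto
qed

section \<open>Winning strategies are confined to the iterates\<close>

text \<open>A history stuck at the duplicator's turn would be a maximal play lost by the duplicator,
  and at such a turn \<open>h\<close> can only be extended by \<open>\<sigma> h\<close>.\<close>

lemma winning_strategy_move:
  assumes win: "winning_strategy F X \<alpha> \<sigma> v" and h: "follows F X \<alpha> \<sigma> v h"
    and turn: "duplicator_turn (last h)"
  shows "move F X \<alpha> (last h) (\<sigma> h) \<and> follows F X \<alpha> \<sigma> v (h @ [\<sigma> h])"
proof -
  have "\<not> maximal_play F X \<alpha> \<sigma> v (Finite h)"
    using win turn unfolding winning_strategy_def by (metis duplicator_wins.simps(1))
  then obtain w where "follows F X \<alpha> \<sigma> v (h @ [w])" using h by auto
  then have "move F X \<alpha> (last h) (\<sigma> h)"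
    by (cases rule: follows.cases) (use h turn in \<open>auto elim: follows.cases\<close>)
  with h turn show ?thesis by (auto intro: follows.duplicator)
qed

text \<open>This packages the four steps as one round between \<open>Pos1\<close> positions, leaving
  the spoiler's choices arbitrary. Histories are carried along because \<open>\<sigma>\<close> may
  depend on them.\<close>

lemma winning_strategy_round:
  assumes win: "winning_strategy F X \<alpha> \<sigma> v" and h: "follows F X \<alpha> \<sigma> v h" and x: "last h = Pos1 x"
  obtains p where "p j = q" "le2F F (Mor2 F X q (\<alpha> (x j))) (Mor2 F X (p (\<not> j)) (\<alpha> (x (\<not> j))))"
    "\<And>l y. y \<in> X \<Longrightarrow> p l y \<Longrightarrow>
      \<exists>h' x'. follows F X \<alpha> \<sigma> v h' \<and> last h' = Pos1 x' \<and> x' l = y \<and> x' (\<not> l) \<in> X \<and> p (\<not> l) (x' (\<not> l))"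
proof -
  let ?h2 = "h @ [Pos2 x j q]"
  have "follows F X \<alpha> \<sigma> v ?h2"
    using h x by (intro follows.spoiler) (auto intro: move.step1)
  then have m2: "move F X \<alpha> (Pos2 x j q) (\<sigma> ?h2)" and h3: "follows F X \<alpha> \<sigma> v (?h2 @ [\<sigma> ?h2])"
    using winning_strategy_move[OF win] by fastforce+
  from m2 obtain p where p: "\<sigma> ?h2 = Pos3 p" "p j = q"
    and le: "le2F F (Mor2 F X q (\<alpha> (x j))) (Mor2 F X (p (\<not> j)) (\<alpha> (x (\<not> j))))"
    by (cases rule: move.cases) auto
  have "\<exists>h' x'. follows F X \<alpha> \<sigma> v h' \<and> last h' = Pos1 x' \<and> x' l = y \<and> x' (\<not> l) \<in> X \<and> p (\<not> l) (x' (\<not> l))"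
    if y: "y \<in> X" "p l y" for l y
  proof -
    let ?h4 = "(?h2 @ [\<sigma> ?h2]) @ [Pos4 p l y]"
    have "follows F X \<alpha> \<sigma> v ?h4"
      by (rule follows.spoiler[OF h3]) (auto simp: p(1) intro: move.step3 y)
    then have m4: "move F X \<alpha> (Pos4 p l y) (\<sigma> ?h4)" and h5: "follows F X \<alpha> \<sigma> v (?h4 @ [\<sigma> ?h4])"
      using winning_strategy_move[OF win, of ?h4] by auto
    from m4 obtain x' where "\<sigma> ?h4 = Pos1 x'" "x' l = y" "x' (\<not> l) \<in> X" "p (\<not> l) (x' (\<not> l))"
      by (cases rule: move.cases) auto
    with h5 show ?thesis by (metis last_snoc)
  qed
  with p le show thesis by (intro that)
qed

text \<open>The history is generalised in the induction: a round ends in a longer history following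
  the same \<open>\<sigma>\<close>, so the induction hypothesis applies to the new pair and
  contradicts the spoiler's escape from a class.\<close>

lemma winning_strategy_iterate:
  fixes F :: "('u::infinite, 'f) set_functor"
  assumes F: "is_functor F"
    and \<Lambda>: "\<forall>ev\<in>\<Lambda>. monotone_eval F ev" "separating F \<Lambda>"
    and \<alpha>: "\<alpha> \<in> X \<rightarrow> Ob F X" and win: "winning_strategy F X \<alpha> \<sigma> v"
  shows "follows F X \<alpha> \<sigma> v h \<Longrightarrow> last h = Pos1 x \<Longrightarrow> (\<And>b. x b \<in> X) \<Longrightarrow>
    (x False, x True) \<in> (F_alpha F X \<alpha> ^^ n) (X \<times> X)"
proof (induction n arbitrary: h x)
  case 0
  then show ?case by simp
next
  case (Suc n)
  let ?S = "(F_alpha F X \<alpha> ^^ n) (X \<times> X)"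
  have "Mor2 F X (\<lambda>x. x \<in> P) (\<alpha> (x False)) = Mor2 F X (\<lambda>x. x \<in> P) (\<alpha> (x True))" if P: "P \<in> X // ?S" for P
  proof (rule ccontr)
    assume ne: "Mor2 F X (\<lambda>x. x \<in> P) (\<alpha> (x False)) \<noteq> Mor2 F X (\<lambda>x. x \<in> P) (\<alpha> (x True))"
    have t: "\<alpha> (x b) \<in> Ob F X" for b using \<alpha> Suc.prems(3) by auto
    obtain j where j: "\<And>p. le2F F (Mor2 F X (\<lambda>x. x \<in> P) (\<alpha> (x j))) (Mor2 F X p (\<alpha> (x (\<not> j)))) \<Longrightarrow>
        \<exists>y\<in>X. p y \<and> y \<notin> P"
      by (rule spoiler_choice[OF F \<Lambda>, of "\<lambda>b. \<alpha> (x b)", OF t ne]) blast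
    obtain p where pj: "p j = (\<lambda>x. x \<in> P)"
      and le: "le2F F (Mor2 F X (\<lambda>x. x \<in> P) (\<alpha> (x j))) (Mor2 F X (p (\<not> j)) (\<alpha> (x (\<not> j))))"
      and p: "\<And>l y. y \<in> X \<Longrightarrow> p l y \<Longrightarrow> \<exists>h' x'. follows F X \<alpha> \<sigma> v h' \<and> last h' = Pos1 x' \<and> x' l = y \<and>
        x' (\<not> l) \<in> X \<and> p (\<not> l) (x' (\<not> l))"
      by (rule winning_strategy_round[OF win Suc.prems(1,2)]) blast
    \<comment> \<open>The spoiler picks \<open>y\<close> outside \<open>P\<close> from the
      duplicator's predicate; the reply must satisfy \<open>p j\<close> and so lies in
      \<open>P\<close>.\<close>
    obtain y where y: "y \<in> X" "p (\<not> j) y" "y \<notin> P" using j[OF le] by blast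
    from p[OF y(1,2)] obtain h' x' where h': "follows F X \<alpha> \<sigma> v h'" "last h' = Pos1 x'"
      and x': "x' (\<not> j) = y" "x' j \<in> X" "x' j \<in> P"
      using pj by auto
    have "x' b \<in> X" for b using x' y(1) by (cases "b = j") auto
    with Suc.IH[OF h'] have "(x' False, x' True) \<in> ?S" by blast
    then have "(x' j, x' (\<not> j)) \<in> ?S"
      using equiv_F_alpha_iterate[where F = F and X = X and \<alpha> = \<alpha> and n = n] by (cases j) (auto simp: equiv_def dest: symD)
    then show False
      using in_quotient_imp_closed[OF equiv_F_alpha_iterate P x'(3)] x'(1) y(3) by simp
  qed
  with Suc.IH[OF Suc.prems] show ?case by (simp add: F_alpha_def[of F X \<alpha> ?S])
qed

section \<open>The duplicator's strategy from an invariant\<close>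

text \<open>This is what the duplicator maintains for an equivalence \<open>R\<close>. The clause
  for \<open>Pos3\<close> says that both predicates have the same \<open>R\<close>-saturation in
  \<open>X\<close>; at \<open>Pos4\<close> only the match for the chosen point is still
  owed.\<close>

fun invariant_position :: "'u set \<Rightarrow> ('u \<times> 'u) set \<Rightarrow> 'u position \<Rightarrow> bool" where
  "invariant_position X R (Pos1 x) \<longleftrightarrow> (x False, x True) \<in> R"
| "invariant_position X R (Pos2 x j q) \<longleftrightarrow> (x False, x True) \<in> R"
| "invariant_position X R (Pos3 p) \<longleftrightarrow> (\<forall>l. \<forall>y\<in>X. p l y \<longrightarrow> (\<exists>z\<in>X. p (\<not> l) z \<and> (y, z) \<in> R))"
| "invariant_position X R (Pos4 p l y) \<longleftrightarrow> (\<exists>z\<in>X. p (\<not> l) z \<and> (y, z) \<in> R)"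

lemma invariant_position_spoiler:
  assumes "invariant_position X R v" "\<not> duplicator_turn v" "move F X \<alpha> v w"
  shows "invariant_position X R w"
  using assms(3,1,2) by (cases rule: move.cases) auto

lemma invariant_position_duplicator:
  assumes F: "is_functor F" and sep: "separable_by_singletons F" and \<alpha>: "\<alpha> \<in> X \<rightarrow> Ob F X"
    and R: "equiv X R" and fix_R: "F_alpha F X \<alpha> R = R"
    and inv: "invariant_position X R v" and turn: "duplicator_turn v"
  shows "\<exists>w. move F X \<alpha> v w \<and> invariant_position X R w"
proof (cases v)
  case (Pos2 x j q)
  have R_sym: "(b, a) \<in> R" if "(a, b) \<in> R" for a b using R that by (auto simp: equiv_def dest: symD)
  have R_trans: "(a, c) \<in> R" if "(a, b) \<in> R" "(b, c) \<in> R" for a b c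
    using R that by (auto simp: equiv_def dest: transD)
  have R_refl: "(a, a) \<in> R" if "a \<in> X" for a using R that by (auto simp: equiv_def refl_on_def)
  have R_X: "a \<in> X" "b \<in> X" if "(a, b) \<in> R" for a b using R that by (auto simp: equiv_def refl_on_def)
  have x: "(x j, x (\<not> j)) \<in> R" using inv Pos2 R_sym by (cases j) auto
  have t: "\<alpha> (x j) \<in> Ob F X" using \<alpha> R_X[OF x] by auto
  \<comment> \<open>The saturation of \<open>q\<close> lies above \<open>q\<close> by reflexivity,
    and being \<open>R\<close>-invariant it has the same value under \<open>F\<close> at both
    states.\<close>
  define sat where "sat y \<longleftrightarrow> (\<exists>z\<in>X. q z \<and> (y, z) \<in> R)" for y
  define p where "p l = (if l = j then q else sat)" for l
  have "sat a = sat b" if "(a, b) \<in> R" for a b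
    unfolding sat_def using that R_sym R_trans by blast
  then have eq: "Mor2 F X sat (\<alpha> (x j)) = Mor2 F X sat (\<alpha> (x (\<not> j)))"
    using F_alpha_saturated[OF F sep \<alpha> R] x fix_R by blast
  have "le2F F (Mor2 F X q (\<alpha> (x j))) (Mor2 F X sat (\<alpha> (x j)))"
    by (rule le2F_Mor2[OF F t]) (use R_refl in \<open>auto simp: sat_def\<close>)
  then have "move F X \<alpha> v (Pos3 p)"
    unfolding Pos2 by (intro move.step2) (auto simp: p_def eq)
  moreover have "\<exists>z\<in>X. p (\<not> l) z \<and> (y, z) \<in> R" if "y \<in> X" "p l y" for l y
    using that R_refl by (cases "l = j") (auto simp: p_def sat_def)
  ultimately show ?thesis by (intro exI[of _ "Pos3 p"]) auto
next
  case (Pos4 p l y)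
  then obtain z where z: "z \<in> X" "p (\<not> l) z" "(y, z) \<in> R" using inv by auto
  \<comment> \<open>Both orientations occur, as the spoiler's point \<open>y\<close> sits at index
    \<open>l\<close>, which may be either one.\<close>
  then have "(z, y) \<in> R" using R by (auto simp: equiv_def dest: symD)
  let ?x = "\<lambda>b. if b = l then y else z"
  have "move F X \<alpha> v (Pos1 ?x)" unfolding Pos4 using z by (intro move.step4) auto
  moreover have "invariant_position X R (Pos1 ?x)" using z \<open>(z, y) \<in> R\<close> by (cases l) auto
  ultimately show ?thesis by blast
qed (use turn in auto)

text \<open>Choosing any legal move that keeps \<open>Inv\<close> gives a positional strategy. It
  never gets stuck at the duplicator's turn, and infinite plays are won by definition.\<close>

lemma winning_strategy_of_invariant:
  assumes dup: "\<And>u. Inv u \<Longrightarrow> duplicator_turn u \<Longrightarrow> \<exists>w. move F X \<alpha> u w \<and> Inv w"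
    and spo: "\<And>u w. Inv u \<Longrightarrow> \<not> duplicator_turn u \<Longrightarrow> move F X \<alpha> u w \<Longrightarrow> Inv w"
    and v: "Inv v"
  shows "\<exists>\<sigma>. winning_strategy F X \<alpha> \<sigma> v"
proof
  let ?\<sigma> = "\<lambda>h. SOME w. move F X \<alpha> (last h) w \<and> Inv w"
  have \<sigma>: "move F X \<alpha> (last h) (?\<sigma> h) \<and> Inv (?\<sigma> h)" if "Inv (last h)" "duplicator_turn (last h)" for h
    using someI_ex[OF dup[OF that]] .
  have inv: "Inv (last h)" if "follows F X \<alpha> ?\<sigma> v h" for h
    using that by induction (use v spo \<sigma> in auto)
  have "duplicator_wins \<pi>" if max: "maximal_play F X \<alpha> ?\<sigma> v \<pi>" for \<pi>
  proof (cases \<pi>)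
    case (Finite h)
    with max have h: "follows F X \<alpha> ?\<sigma> v h" and stuck: "\<And>w. \<not> follows F X \<alpha> ?\<sigma> v (h @ [w])" by auto
    then show ?thesis
      using follows.duplicator[OF h] \<sigma>[OF inv[OF h]] Finite by auto
  qed simp
  then show "winning_strategy F X \<alpha> ?\<sigma> v" by (simp add: winning_strategy_def)
qed

theorem theorem2:
  fixes F :: "('u::infinite, 'f) set_functor" and X :: "'u set" and \<alpha> :: "'u \<Rightarrow> 'f"
  assumes "is_functor F"
    and "preserves_weak_pullbacks F"
    and "\<exists>\<Lambda>. (\<forall>ev\<in>\<Lambda>. monotone_eval F ev) \<and> separating F \<Lambda>"
    and "separable_by_singletons F"
    and "finite X"
    and "\<alpha> \<in> X \<rightarrow> Ob F X"
  shows "nu_F_alpha F X \<alpha> = W_alpha F X \<alpha>"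
proof -
  let ?N = "nu_F_alpha F X \<alpha>" and ?v = "\<lambda>x0 x1. Pos1 (\<lambda>j. if j then x1 else x0)"
  obtain \<Lambda> where \<Lambda>: "\<forall>ev\<in>\<Lambda>. monotone_eval F ev" "separating F \<Lambda>" using assms(3) by blast
  obtain n where n: "?N = (F_alpha F X \<alpha> ^^ n) (X \<times> X)" and fix_N: "F_alpha F X \<alpha> ?N = ?N"
    by (rule nu_F_alpha_iterate[OF assms(1,4,6,5)])
  have eq: "equiv X ?N" unfolding n by (rule equiv_F_alpha_iterate)
  show ?thesis
  proof (intro equalityI subrelI)
    fix x0 x1 assume x: "(x0, x1) \<in> ?N"
    have "\<exists>\<sigma>. winning_strategy F X \<alpha> \<sigma> (?v x0 x1)"
      by (rule winning_strategy_of_invariant[where Inv = "invariant_position X ?N"])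
        (use invariant_position_duplicator[OF assms(1,4,6) eq fix_N] invariant_position_spoiler x in auto)
    moreover have "x0 \<in> X" "x1 \<in> X" using x eq by (auto simp: equiv_def refl_on_def)
    ultimately show "(x0, x1) \<in> W_alpha F X \<alpha>" by (simp add: W_alpha_def)
  next
    fix x0 x1 assume "(x0, x1) \<in> W_alpha F X \<alpha>"
    then obtain \<sigma> where x: "x0 \<in> X" "x1 \<in> X" and win: "winning_strategy F X \<alpha> \<sigma> (?v x0 x1)"
      by (auto simp: W_alpha_def)
    \<comment> \<open>The one-element history starts the argument, and \<open>n\<close> is a stage
      at which the iteration has reached the greatest fixpoint.\<close>
    show "(x0, x1) \<in> ?N"
      using winning_strategy_iterate[OF assms(1) \<Lambda> assms(6) win follows.start,
          where n = n and x = "\<lambda>j. if j then x1 else x0"] x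
      unfolding n by simp
  qed
qed

end
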